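(* Let $d\in\mathbb{N}$ and let $\mu$ be a Borel probability measure on $\mathbb{R}^{d}$ with polylogarithmic Fourier decay, i.e. there is a constant $\alpha>0$ such that $\widehat{\mu}(\mathbf{t})=O\big((\log|\mathbf{t}|_{\infty})^{-\alpha}\big)$ as $|\mathbf{t}|_{\infty}\to\infty$. Let $(A_n)_{n\in\mathbb{N}}$ be a sequence of expanding integral $d\times d$ matrices, and assume that there is a constant $K>1$ such that $\sigma(A_{n+1}A_n^{-1})\ge K$ for all $n\in\mathbb{N}$. Then for $\mu$-almost every $\mathbf{x}\in\mathbb{R}^d$ the sequence $(A_n\mathbf{x})_{n\ge 1}$ is equidistributed modulo one.
   Context: For $\mathbf{t}\in\mathbb{R}^d$, $|\mathbf{t}|_\infty=\max_{1\le i\le d}|t_i|$, and $\widehat{\mu}(\mathbf{t})=\int e^{-2\pi i\langle \mathbf{t},\mathbf{x}\rangle}\,d\mu(\mathbf{x})$, where $\langle\mathbf{t},\mathbf{x}\rangle=t_1x_1+\cdots+t_dx_d$. For a real $d\times d$ matrix $A$, $\sigma(A)=\inf\{\|A\mathbf{x}\|_2:\|\mathbf{x}\|_2=1\}$ denotes its smallest singular value. An expanding integral matrix is a $d\times d$ matrix with integer entries all of whose (complex) eigenvalues have modulus $>1$; in particular it is invertible over $\mathbb{R}$. A sequence $(\mathbf{x}_n)_{n\in\mathbb{N}}$ in $\mathbb{R}^d$ is equidistributed modulo one if for every parallelepiped $[a_1,b_1]\times\cdots\times[a_d,b_d]\subseteq[0,1]^d$, $$\lim_{N\to\infty}\frac{\#\{1\le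 n\le N:\mathbf{x}_n\in[a_1,b_1]\times\cdots\times[a_d,b_d]\ (\mathrm{mod}\ 1)\}}{N}=\prod_{i=1}^d(b_i-a_i).$$ *)

theory Defs
  imports "HOL-Probability.Probability" "HOL-Library.Landau_Symbols"
begin

definition fourier_transform :: "(real ^ 'd) measure \<Rightarrow> real ^ 'd \<Rightarrow> complex" where
  "fourier_transform \<mu> t =
     (LINT x|\<mu>. exp (- (2 * complex_of_real pi * \<i> * complex_of_real (t \<bullet> x))))"

text \<open>The filter \<open>filtercomap infnorm at_top\<close> is literally
  "as the maximum norm of \<open>t\<close> tends to infinity".\<close>

definition polylog_fourier_decay :: "(real ^ 'd) measure \<Rightarrow> bool" where
  "polylog_fourier_decay \<mu> \<longleftrightarrow>
     (\<exists>\<alpha>>0. (\<lambda>t. norm (fourier_transform \<mu> t))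
        \<in> O[filtercomap infnorm at_top](\<lambda>t. ln (infnorm t) powr (- \<alpha>)))"

definition smallest_singular_value :: "real ^ 'd ^ 'd \<Rightarrow> real" where
  "smallest_singular_value A = Inf {norm (A *v x) | x. norm x = 1}"

definition eigenvalue :: "complex ^ 'd ^ 'd \<Rightarrow> complex \<Rightarrow> bool" where
  "eigenvalue A c \<longleftrightarrow> (\<exists>v. v \<noteq> 0 \<and> A *v v = c *s v)"

definition expanding_integral_matrix :: "real ^ 'd ^ 'd \<Rightarrow> bool" where
  "expanding_integral_matrix A \<longleftrightarrow>
     (\<forall>i j. A $ i $ j \<in> \<int>) \<and>
     (\<forall>c. eigenvalue (\<chi> i j. complex_of_real (A $ i $ j)) c \<longrightarrow> norm c > 1)"

text \<open>Membership of \<open>x n\<close> in the box modulo one means that some translate of \<open>x n\<close> by an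
  integer vector lies in the box. Thus \<open>0\<close> and \<open>1\<close> are identified in each coordinate, also when
  the box reaches up to \<open>1\<close>. The sequence is indexed from \<open>1\<close>, so \<open>x 0\<close> plays no role.\<close>

definition equidistributed_mod_one :: "(nat \<Rightarrow> real ^ 'd) \<Rightarrow> bool" where
  "equidistributed_mod_one x \<longleftrightarrow>
     (\<forall>a b. (\<forall>i. 0 \<le> a $ i \<and> a $ i \<le> b $ i \<and> b $ i \<le> 1) \<longrightarrow>
        (\<lambda>N. real (card {n \<in> {1..N}. \<exists>k. (\<forall>i. k $ i \<in> \<int>) \<and> x n - k \<in> cbox a b}) / real N)
          \<longlonglongrightarrow> (\<Prod>i\<in>UNIV. b $ i - a $ i))"

end

theory Submission
  imports Defs "HOL-Real_Asymp.Real_Asymp"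
begin

text \<open>
  By Weyl's criterion (\<open>weyl_criterion\<close>) the claim reduces to the following: for every integer
  vector \<open>h \<noteq> 0\<close> and almost every \<open>x\<close>, the averages of \<open>exp (2 \<pi> i \<langle>h, A\<^sub>n x\<rangle>)\<close>
  tend to \<open>0\<close>. There are only countably many \<open>h\<close>, so the exceptional null sets may be united.

  Since \<open>\<langle>h, A\<^sub>n x\<rangle> = \<langle>t\<^sub>n, x\<rangle>\<close> for \<open>t\<^sub>n = A\<^sub>n\<^sup>T h\<close>, the correlation of the
  \<open>n\<close>-th and the \<open>m\<close>-th exponential under \<open>\<mu>\<close> is the Fourier transform of \<open>\<mu>\<close> at
  \<open>t\<^sub>m - t\<^sub>n\<close>. Write \<open>A\<^sub>n = D A\<^sub>m\<close> for \<open>m < n\<close>. The smallest singular value of \<open>D\<close>, and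
  hence of its transpose, is at least \<open>K\<^sup>n\<^sup>-\<^sup>m\<close>, so \<open>D\<^sup>T h\<close> is at least \<open>K > 1\<close> times as long
  as \<open>h\<close> and cannot cancel against it; applying \<open>A\<^sub>m\<^sup>T\<close> expands the difference by a
  further factor of at least the order of \<open>K\<^sup>m\<close>. So \<open>\<bar>t\<^sub>n - t\<^sub>m\<bar>\<close> is at least a constant times \<open>K\<^sup>n\<close> (\<open>frequency_gap\<close>). The
  logarithm turns this exponential gap into a linear one, and the polylogarithmic decay of the
  Fourier transform becomes a bound \<open>C n\<^sup>-\<^sup>\<alpha>\<close> on the correlations
  (\<open>polylog_fourier_decay_along_gaps\<close>).

  Polynomial decay of correlations, with an arbitrarily small exponent, suffices for almost sure
  convergence of the averages (\<open>AE_averages_tendsto_0\<close>, a case of the theorem of Davenport,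
  Erdos and LeVeque): the second moments of the averages are summable along the sparse sequence
  \<open>N = k\<^sup>q\<close> for a large exponent \<open>q\<close>, and consecutive members of this sequence have ratio
  tending to \<open>1\<close>, so that convergence along it implies convergence.
\<close>

section \<open>Characters of the torus\<close>

text \<open>
  Frequencies are functions \<open>'d \<Rightarrow> int\<close> instead of vectors with integer components: this type is
  countable, so that almost sure statements for each frequency hold for all of them at once.
\<close>

definition character :: "('d::finite \<Rightarrow> int) \<Rightarrow> real ^ 'd \<Rightarrow> complex" where
  "character h x = cis (2 * pi * (\<Sum>i\<in>UNIV. of_int (h i) * x $ i))"

text \<open>
  This embeds the quotient of \<open>\<real>\<^sup>d\<close> by the integer lattice into a product of circles. A set of
  points modulo one thus becomes a compact subset of a metric space, to which the
  Stone-Weierstrass theorem and distance functions apply.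
\<close>

definition torus_point :: "real ^ 'd \<Rightarrow> complex ^ 'd" where
  "torus_point x = (\<chi> i. cis (2 * pi * x $ i))"

lemma continuous_on_torus_point: "continuous_on S torus_point"
  unfolding torus_point_def by (intro continuous_intros)

lemma measurable_torus_point [measurable]: "torus_point \<in> borel_measurable borel"
  by (intro borel_measurable_continuous_onI continuous_on_torus_point)

lemma continuous_on_character: "continuous_on S (character h)"
  unfolding character_def by (intro continuous_intros)

lemma measurable_character [measurable]: "character h \<in> borel_measurable borel"
  by (intro borel_measurable_continuous_onI continuous_on_character)

lemma norm_character [simp]: "norm (character h x) = 1"
  by (simp add: character_def)

lemma character_0 [simp]: "character (\<lambda>_. 0) x = 1"
  by (simp add: character_def)

lemma character_mult: "character h x * character h' x = character (\<lambda>i. h i + h' i) x"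
  by (simp add: character_def cis_mult sum.distrib algebra_simps)

lemma character_prod:
  fixes h :: "'d::finite \<Rightarrow> int"
  shows "character h x = (\<Prod>i\<in>UNIV. cis (2 * pi * of_int (h i) * x $ i))"
proof -
  have cis_sum: "cis (\<Sum>i\<in>I. f i) = (\<Prod>i\<in>I. cis (f i))" if "finite I" for I and f :: "'d \<Rightarrow> real"
    using that by induction (auto simp: cis_mult[symmetric])
  show ?thesis
    by (simp add: character_def sum_distrib_left mult.assoc cis_sum)
qed

lemma cis_2pi_eq_iff: "cis (2 * pi * s) = cis (2 * pi * t) \<longleftrightarrow> s - t \<in> \<int>"
proof -
  have "cis (2 * pi * s) = cis (2 * pi * t) \<longleftrightarrow> cis (2 * pi * (s - t)) = 1"
    by (simp add: right_diff_distrib cis_divide[symmetric] field_simps)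
  also have "\<dots> \<longleftrightarrow> s - t \<in> \<int>"
  proof
    assume "cis (2 * pi * (s - t)) = 1"
    then have "cos (2 * pi * (s - t)) = 1" by (simp add: complex_eq_iff)
    then obtain n :: int where "2 * pi * (s - t) = of_int n * 2 * pi"
      by (auto simp: cos_one_2pi_int)
    then have "s - t = of_int n" by simp
    then show "s - t \<in> \<int>" by simp
  qed simp
  finally show ?thesis .
qed

lemma torus_point_eq_iff: "torus_point x = torus_point y \<longleftrightarrow> (\<forall>i. x $ i - y $ i \<in> \<int>)"
  by (simp add: torus_point_def vec_eq_iff cis_2pi_eq_iff)

lemma torus_point_image_cube: "torus_point x \<in> torus_point ` cbox 0 1"
proof
  show "torus_point x = torus_point (\<chi> i. frac (x $ i))"
    by (simp add: torus_point_eq_iff frac_def)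
  show "(\<chi> i. frac (x $ i)) \<in> cbox 0 1"
    by (simp add: mem_box_cart less_imp_le frac_lt_1)
qed

text \<open>
  Lebesgue measure on the unit cube, that is Haar measure on the torus. Building it as a product
  measure makes the measure of a box and the integral of a character factor over the coordinates.
\<close>

definition cube_measure :: "(real ^ 'd) measure" where
  "cube_measure = distr (PiM UNIV (\<lambda>_. uniform_measure lborel {0..1})) borel (\<lambda>u. \<chi> i. u i)"

lemma prob_space_uniform_unit: "prob_space (uniform_measure lborel {0..1::real})"
  by (rule prob_space_uniform_measure) auto

lemma measurable_vec_lambda:
  "(\<lambda>u. \<chi> i. u i) \<in> PiM UNIV (\<lambda>_::'d::finite. uniform_measure lborel {0..1::real}) \<rightarrow>\<^sub>M borel"
proof -
  have "sets (PiM UNIV (\<lambda>_::'d. uniform_measure lborel {0..1::real})) = sets (PiM UNIV (\<lambda>_::'d. borel))"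
    by (intro sets_PiM_cong) auto
  also have "\<dots> = sets borel" by (rule sets_PiM_equal_borel)
  finally have *: "sets (PiM UNIV (\<lambda>_::'d. uniform_measure lborel {0..1::real})) = sets borel" .
  have "(\<lambda>u. \<chi> i. u i) \<in> borel_measurable (borel :: ('d \<Rightarrow> real) measure)"
    by (intro borel_measurable_continuous_onI continuous_intros continuous_on_product_coordinates)
  then show ?thesis
    using measurable_cong_sets[OF * refl] by blast
qed

lemma prob_space_cube_measure: "prob_space cube_measure"
proof -
  interpret product_prob_space "\<lambda>_. uniform_measure lborel {0..1::real}" UNIV
    by (intro product_prob_spaceI prob_space_uniform_unit)
  show ?thesis
    unfolding cube_measure_def by (intro prob_space_distr measurable_vec_lambda)
qed

lemma sets_cube_measure [measurable_cong, simp]: "sets cube_measure = sets borel"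
  by (simp add: cube_measure_def)

lemma space_cube_measure [simp]: "space cube_measure = UNIV"
  by (simp add: cube_measure_def)

lemma measure_cube_measure_product:
  assumes [measurable]: "\<And>i. B i \<in> sets borel"
  shows "measure cube_measure {x :: real ^ 'd. \<forall>i. x $ i \<in> B i}
       = (\<Prod>i\<in>UNIV. measure (uniform_measure lborel {0..1}) (B i))"
proof -
  interpret finite_product_prob_space "\<lambda>_. uniform_measure lborel {0..1::real}" "UNIV :: 'd set"
    by (intro finite_product_prob_space.intro finite_product_sigma_finite.intro
        finite_product_sigma_finite_axioms.intro product_sigma_finite.intro product_prob_spaceI
        prob_space_uniform_unit prob_space_imp_sigma_finite finite)
  have [measurable]: "{x :: real ^ 'd. \<forall>i. x $ i \<in> B i} \<in> sets borel"
  proof -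
    have [measurable]: "(\<lambda>x :: real ^ 'd. x $ i) \<in> borel_measurable borel" for i
      by (intro borel_measurable_continuous_onI continuous_intros)
    have "{x :: real ^ 'd. \<forall>i. x $ i \<in> B i} = {x \<in> space borel. \<forall>i\<in>UNIV. x $ i \<in> B i}" by simp
    also have "\<dots> \<in> sets borel" by measurable
    finally show ?thesis .
  qed
  have "measure cube_measure {x :: real ^ 'd. \<forall>i. x $ i \<in> B i}
      = measure (PiM UNIV (\<lambda>_. uniform_measure lborel {0..1})) (PiE UNIV B)"
    unfolding cube_measure_def
    by (subst measure_distr[OF measurable_vec_lambda])
      (auto simp: space_PiM PiE_def intro!: arg_cong2[where f = measure])
  also have "\<dots> = (\<Prod>i\<in>UNIV. measure (uniform_measure lborel {0..1}) (B i))"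
    by (rule prob_times) simp
  finally show ?thesis .
qed

lemma measure_cube_measure_cbox:
  assumes "\<And>i. 0 \<le> a $ i" "\<And>i. a $ i \<le> b $ i" "\<And>i. b $ i \<le> 1"
  shows "measure cube_measure (cbox a b) = (\<Prod>i\<in>UNIV. b $ i - a $ i)"
proof -
  have "cbox a b = {x. \<forall>i. x $ i \<in> {a $ i..b $ i}}" by (auto simp: mem_box_cart)
  then have "measure cube_measure (cbox a b) = (\<Prod>i\<in>UNIV. measure (uniform_measure lborel {0..1}) {a $ i..b $ i})"
    by (simp only:) (rule measure_cube_measure_product, simp)
  moreover have "measure (uniform_measure lborel {0..1}) {a $ i..b $ i} = b $ i - a $ i" for i
  proof -
    have "{0..1} \<inter> {a $ i..b $ i} = {a $ i..b $ i}" using assms[of i] by auto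
    then have "measure (uniform_measure lborel {0..1}) {a $ i..b $ i} = measure lborel {a $ i..b $ i} / measure lborel {0..1::real}"
      by (subst measure_uniform_measure) auto
    then show ?thesis using assms(2)[of i] by simp
  qed
  ultimately show ?thesis by (simp only:)
qed

lemma measure_cube_measure_box:
  assumes "\<And>i. 0 \<le> a $ i" "\<And>i. a $ i \<le> b $ i" "\<And>i. b $ i \<le> 1"
  shows "measure cube_measure (box a b) = (\<Prod>i\<in>UNIV. b $ i - a $ i)"
proof -
  have "box a b = {x. \<forall>i. x $ i \<in> {a $ i<..<b $ i}}" by (auto simp: mem_box_cart)
  then have "measure cube_measure (box a b) = (\<Prod>i\<in>UNIV. measure (uniform_measure lborel {0..1}) {a $ i<..<b $ i})"
    by (simp only:) (rule measure_cube_measure_product, simp)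
  moreover have "measure (uniform_measure lborel {0..1}) {a $ i<..<b $ i} = b $ i - a $ i" for i
  proof -
    have "{0..1} \<inter> {a $ i<..<b $ i} = {a $ i<..<b $ i}" using assms[of i] by auto
    then have "measure (uniform_measure lborel {0..1}) {a $ i<..<b $ i} = measure lborel {a $ i<..<b $ i} / measure lborel {0..1::real}"
      by (subst measure_uniform_measure) auto
    then show ?thesis using assms(2)[of i] by simp
  qed
  ultimately show ?thesis by (simp only:)
qed

text \<open>
  Representatives modulo one are unique inside the open cube, so this fact removes the
  identification of opposite faces from all computations of measures.
\<close>

lemma AE_cube_measure_box: "AE x in cube_measure. x \<in> box 0 (1 :: real ^ 'd)"
proof -
  interpret prob_space "cube_measure :: (real ^ 'd) measure" by (rule prob_space_cube_measure)
  have "prob (box 0 1) = 1" by (simp add: measure_cube_measure_box)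
  then show ?thesis by (subst AE_in_set_eq_1) simp_all
qed

lemma integral_uniform_unit_cis:
  assumes "k \<noteq> 0"
  shows "(\<integral>t. cis (2 * pi * of_int k * t) \<partial>uniform_measure lborel {0..1}) = 0"
proof -
  define F where "F t = cis (2 * pi * of_int k * t) / (2 * pi * of_int k * \<i>)" for t
  have "(\<integral>t. indicator {0..1} t *\<^sub>R cis (2 * pi * of_int k * t) \<partial>lborel) = F 1 - F 0"
  proof (rule integral_FTC_atLeastAtMost)
    fix t :: real
    have "(cis has_vector_derivative \<i> * cis s) (at s)" for s
      unfolding has_vector_derivative_complex_iff
      by (auto intro!: derivative_eq_intros simp: has_real_derivative_iff_has_vector_derivative[symmetric])
    from vector_diff_chain_at[OF _ this, of "\<lambda>t. 2 * pi * of_int k * t" "2 * pi * of_int k" t]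
    have "((\<lambda>t. cis (2 * pi * of_int k * t)) has_vector_derivative
            (2 * pi * of_int k) *\<^sub>R (\<i> * cis (2 * pi * of_int k * t))) (at t within {0..1})"
      by (auto simp: o_def intro!: derivative_eq_intros has_vector_derivative_at_within
          simp: has_real_derivative_iff_has_vector_derivative[symmetric])
    from has_vector_derivative_mult_left[OF this, of "1 / (2 * pi * of_int k * \<i>)"]
    show "(F has_vector_derivative cis (2 * pi * of_int k * t)) (at t within {0..1})"
      unfolding F_def using assms by (simp add: scaleR_conv_of_real field_simps)
  qed (auto intro!: continuous_intros)
  also have "F 1 = F 0" by (simp add: F_def)
  finally have "(\<integral>t. indicator {0..1} t *\<^sub>R cis (2 * pi * of_int k * t) \<partial>lborel) = 0"
    by simp
  moreover have "uniform_measure lborel {0..1} = density lborel (\<lambda>t::real. ennreal (indicator {0..1} t))"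
    by (simp add: uniform_measure_def ennreal_indicator divide_ennreal_def)
  moreover have "(\<lambda>t. cis (2 * pi * of_int k * t)) \<in> borel_measurable borel"
    by (intro borel_measurable_continuous_onI continuous_intros)
  ultimately show ?thesis
    by (simp add: integral_density)
qed

lemma integral_cube_measure_character:
  fixes h :: "'d::finite \<Rightarrow> int"
  shows "(\<integral>x. character h x \<partial>cube_measure) = (if h = (\<lambda>_. 0) then 1 else 0)"
proof -
  interpret product_prob_space "\<lambda>_. uniform_measure lborel {0..1::real}" "UNIV :: 'd set"
    by (intro product_prob_spaceI prob_space_uniform_unit)
  have "(\<integral>x. character h x \<partial>cube_measure)
      = (\<integral>u. character h (\<chi> i. u i) \<partial>PiM UNIV (\<lambda>_. uniform_measure lborel {0..1}))"
    unfolding cube_measure_def by (subst integral_distr[OF measurable_vec_lambda]) auto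
  also have "\<dots> = (\<integral>u. (\<Prod>i\<in>UNIV. cis (2 * pi * of_int (h i) * u i)) \<partial>PiM UNIV (\<lambda>_. uniform_measure lborel {0..1}))"
    by (simp add: character_prod)
  also have "\<dots> = (\<Prod>i\<in>UNIV. \<integral>t. cis (2 * pi * of_int (h i) * t) \<partial>uniform_measure lborel {0..1})"
  proof (rule product_integral_prod)
    fix i
    have "(\<lambda>t. cis (2 * pi * of_int (h i) * t)) \<in> borel_measurable borel"
      by (intro borel_measurable_continuous_onI continuous_intros)
    then show "integrable (uniform_measure lborel {0..1}) (\<lambda>t. cis (2 * pi * of_int (h i) * t))"
      by (intro finite_measure.integrable_const_bound[where B = 1] prob_space.finite_measure
          prob_space_uniform_unit) auto
  qed simp
  also have "\<dots> = (if h = (\<lambda>_. 0) then 1 else 0)"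
  proof (cases "h = (\<lambda>_. 0)")
    case True
    then show ?thesis using prob_space.prob_space[OF prob_space_uniform_unit] by simp
  next
    case False
    then obtain i where "h i \<noteq> 0" by auto
    then have "(\<integral>t. cis (2 * pi * of_int (h i) * t) \<partial>uniform_measure lborel {0..1}) = 0"
      by (rule integral_uniform_unit_cis)
    then show ?thesis using False by (auto simp: prod_zero_iff)
  qed
  finally show ?thesis .
qed

section \<open>Trigonometric polynomials and Weyl's criterion\<close>

text \<open>
  A trigonometric polynomial, described by its generation from monomials: this form makes the
  closure under products and the convergence of averages inductions over two cases.
\<close>

inductive trig_poly :: "(real ^ 'd \<Rightarrow> complex) \<Rightarrow> bool" where
  monomial: "trig_poly (\<lambda>x. c * character h x)"
| add: "trig_poly f \<Longrightarrow> trig_poly g \<Longrightarrow> trig_poly (\<lambda>x. f x + g x)"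

lemma trig_poly_const: "trig_poly (\<lambda>x. c)"
  using trig_poly.monomial[of c "\<lambda>_. 0"] by simp

lemma trig_poly_mult:
  assumes "trig_poly f" "trig_poly g"
  shows "trig_poly (\<lambda>x. f x * g x)"
  using assms(1)
proof induction
  case (monomial c h)
  show ?case using assms(2)
  proof induction
    case (monomial c' h')
    have "(\<lambda>x. c * character h x * (c' * character h' x)) = (\<lambda>x. c * c' * character (\<lambda>i. h i + h' i) x)"
      by (simp add: character_mult[symmetric] mult_ac)
    then show ?case by (simp add: trig_poly.monomial)
  next
    case (add f g)
    then show ?case by (simp add: distrib_left trig_poly.add)
  qed
next
  case (add f g)
  then show ?case by (simp add: distrib_right trig_poly.add)
qed

lemma trig_poly_coordinate:
  "trig_poly (\<lambda>x. complex_of_real (Re (torus_point x $ i)))"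
  "trig_poly (\<lambda>x. complex_of_real (Im (torus_point x $ i)))"
proof -
  have e: "character (\<lambda>j. if j = i then k else 0) x = cis (2 * pi * of_int k * x $ i)" for k x
  proof -
    have "(\<Sum>j\<in>UNIV. of_int (if j = i then k else 0) * x $ j) = (\<Sum>j\<in>UNIV. if j = i then of_int k * x $ j else 0)"
      by (intro sum.cong) auto
    then show ?thesis by (simp add: character_def mult_ac)
  qed
  have t: "trig_poly (\<lambda>x. c * cis (2 * pi * x $ i) + c' * cis (- (2 * pi * x $ i)))" for c c'
    using trig_poly.add[OF trig_poly.monomial[of c "\<lambda>j. if j = i then 1 else 0"]
      trig_poly.monomial[of c' "\<lambda>j. if j = i then -1 else 0"]] unfolding e by simp
  show "trig_poly (\<lambda>x. complex_of_real (Re (torus_point x $ i)))"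
  proof -
    have "complex_of_real (Re (torus_point x $ i)) = 1/2 * cis (2 * pi * x $ i) + 1/2 * cis (- (2 * pi * x $ i))" for x
      by (simp add: torus_point_def complex_eq_iff)
    then show ?thesis using t[of "1/2" "1/2"] by simp
  qed
  show "trig_poly (\<lambda>x. complex_of_real (Im (torus_point x $ i)))"
  proof -
    have "complex_of_real (Im (torus_point x $ i)) = -\<i>/2 * cis (2 * pi * x $ i) + \<i>/2 * cis (- (2 * pi * x $ i))" for x
      by (simp add: torus_point_def complex_eq_iff)
    then show ?thesis using t[of "-\<i>/2" "\<i>/2"] by simp
  qed
qed

text \<open>
  The real and imaginary parts of the coordinates of \<open>torus_point\<close> are trigonometric polynomials
  and separate the points of the torus, so the Stone-Weierstrass theorem applies to the functions
  on the torus which pull back to trigonometric polynomials.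
\<close>

lemma trig_poly_dense:
  fixes f :: "complex ^ 'd \<Rightarrow> real"
  assumes "continuous_on UNIV f" "e > 0"
  shows "\<exists>g. trig_poly (\<lambda>x. complex_of_real (g x)) \<and> (\<forall>x. \<bar>f (torus_point x) - g x\<bar> < e)"
proof -
  define T where "T = torus_point ` cbox 0 (1 :: real ^ 'd)"
  have T: "torus_point x \<in> T" for x by (simp add: T_def torus_point_image_cube)
  have "\<exists>g. (continuous_on T g \<and> trig_poly (\<lambda>x. complex_of_real (g (torus_point x))))
          \<and> (\<forall>z\<in>T. \<bar>f z - g z\<bar> < e)"
  proof (rule Stone_Weierstrass_HOL)
    show "compact T"
      unfolding T_def by (intro compact_continuous_image continuous_on_torus_point compact_cbox)
    fix z w assume zw: "z \<in> T \<and> w \<in> T \<and> z \<noteq> w"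
    then obtain i where "z $ i \<noteq> w $ i" by (auto simp: vec_eq_iff)
    then consider "Re (z $ i) \<noteq> Re (w $ i)" | "Im (z $ i) \<noteq> Im (w $ i)"
      by (auto simp: complex_eq_iff)
    then show "\<exists>g. (continuous_on T g \<and> trig_poly (\<lambda>x. complex_of_real (g (torus_point x)))) \<and> g z \<noteq> g w"
    proof cases
      case 1
      then show ?thesis
        by (intro exI[of _ "\<lambda>z. Re (z $ i)"] conjI trig_poly_coordinate continuous_intros)
    next
      case 2
      then show ?thesis
        by (intro exI[of _ "\<lambda>z. Im (z $ i)"] conjI trig_poly_coordinate continuous_intros)
    qed
  next
    show "continuous_on T f" using assms(1) by (rule continuous_on_subset) simp
  qed (auto intro!: continuous_intros trig_poly_const simp: trig_poly.add trig_poly_mult assms)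
  then obtain g where "trig_poly (\<lambda>x. complex_of_real (g (torus_point x)))" "\<forall>z\<in>T. \<bar>f z - g z\<bar> < e"
    by blast
  then show ?thesis using T by (intro exI[of _ "\<lambda>x. g (torus_point x)"]) auto
qed

text \<open>
  Both sides are linear in \<open>f\<close>, and for a single character the hypothesis supplies the limit
  \<open>0\<close>, which is the integral of every non-trivial character.
\<close>

lemma trig_poly_averages:
  assumes weyl: "\<And>h. h \<noteq> (\<lambda>_. 0) \<Longrightarrow> (\<lambda>N. (\<Sum>n\<in>{1..N}. character h (x n)) / of_nat N) \<longlonglongrightarrow> 0"
    and "trig_poly f"
  shows "integrable cube_measure f \<and>
         (\<lambda>N. (\<Sum>n\<in>{1..N}. f (x n)) / of_nat N) \<longlonglongrightarrow> (\<integral>y. f y \<partial>cube_measure)"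
  using assms(2)
proof induction
  case (monomial c h)
  interpret prob_space cube_measure by (rule prob_space_cube_measure)
  have "integrable cube_measure (character h)"
    by (intro integrable_const_bound[where B = 1]) auto
  moreover have "(\<lambda>N. (\<Sum>n\<in>{1..N}. character h (x n)) / of_nat N) \<longlonglongrightarrow> (\<integral>y. character h y \<partial>cube_measure)"
  proof (cases "h = (\<lambda>_. 0)")
    case True
    have "eventually (\<lambda>N. (\<Sum>n\<in>{1..N}. character h (x n)) / of_nat N = 1) sequentially"
      using eventually_gt_at_top[of 0] by eventually_elim (simp add: True)
    then show ?thesis
      unfolding integral_cube_measure_character using True by (simp add: tendsto_eventually)
  next
    case False
    then show ?thesis using weyl by (simp add: integral_cube_measure_character)
  qed
  from tendsto_mult_left[OF this, of c] have
    "(\<lambda>N. (\<Sum>n\<in>{1..N}. c * character h (x n)) / of_nat N) \<longlonglongrightarrow> c * (\<integral>y. character h y \<partial>cube_measure)"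
    by (simp add: sum_distrib_left)
  ultimately show ?case by simp
next
  case (add f g)
  then show ?case
    using tendsto_add[of "\<lambda>N. (\<Sum>n\<in>{1..N}. f (x n)) / of_nat N" _ _ "\<lambda>N. (\<Sum>n\<in>{1..N}. g (x n)) / of_nat N"]
    by (simp add: sum.distrib add_divide_distrib)
qed

lemma continuous_averages:
  fixes f :: "complex ^ 'd \<Rightarrow> real"
  assumes weyl: "\<And>h. h \<noteq> (\<lambda>_. 0) \<Longrightarrow> (\<lambda>N. (\<Sum>n\<in>{1..N}. character h (x n)) / of_nat N) \<longlonglongrightarrow> 0"
    and f: "continuous_on UNIV f"
  shows "(\<lambda>N. (\<Sum>n\<in>{1..N}. f (torus_point (x n))) / real N) \<longlonglongrightarrow> (\<integral>y. f (torus_point y) \<partial>cube_measure)"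
proof (rule LIMSEQ_I)
  interpret prob_space "cube_measure :: (real ^ 'd) measure" by (rule prob_space_cube_measure)
  fix e :: real assume "e > 0"
  then obtain g where g: "trig_poly (\<lambda>x. complex_of_real (g x))" "\<And>x. \<bar>f (torus_point x) - g x\<bar> < e / 3"
    using trig_poly_dense[OF f, of "e / 3"] by auto
  define I J where "I = (\<integral>y. f (torus_point y) \<partial>cube_measure)" and "J = (\<integral>y. g y \<partial>cube_measure)"
  have int: "integrable cube_measure (\<lambda>x. complex_of_real (g x))"
    and lim: "(\<lambda>N. (\<Sum>n\<in>{1..N}. complex_of_real (g (x n))) / of_nat N) \<longlonglongrightarrow> (\<integral>y. complex_of_real (g y) \<partial>cube_measure)"
    using trig_poly_averages[OF weyl g(1)] by auto
  have g_int: "integrable cube_measure g"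
    using int by (simp only: complex_of_real_integrable_eq)
  have [measurable]: "f \<in> borel_measurable borel"
    using f by (rule borel_measurable_continuous_onI)
  have f_int: "integrable cube_measure (\<lambda>y. f (torus_point y))"
  proof (rule Bochner_Integration.integrable_bound)
    show "integrable cube_measure (\<lambda>y. \<bar>g y\<bar> + e / 3)" using g_int by simp
    show "AE y in cube_measure. norm (f (torus_point y)) \<le> norm (\<bar>g y\<bar> + e / 3)"
    proof (rule AE_I2)
      fix y show "norm (f (torus_point y)) \<le> norm (\<bar>g y\<bar> + e / 3)"
        using g(2)[of y] unfolding real_norm_def by linarith
    qed
  qed simp
  have "(\<lambda>N. complex_of_real ((\<Sum>n\<in>{1..N}. g (x n)) / real N)) \<longlonglongrightarrow> complex_of_real J"
    using lim by (simp add: J_def)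
  then have "(\<lambda>N. (\<Sum>n\<in>{1..N}. g (x n)) / real N) \<longlonglongrightarrow> J"
    by (simp only: tendsto_of_real_iff)
  then obtain N0 where N0: "\<And>N. N \<ge> N0 \<Longrightarrow> \<bar>(\<Sum>n\<in>{1..N}. g (x n)) / real N - J\<bar> < e / 3"
    using \<open>e > 0\<close> unfolding LIMSEQ_iff real_norm_def by (metis divide_pos_pos zero_less_numeral)
  have IJ: "\<bar>I - J\<bar> \<le> e / 3"
  proof -
    have "I - J = (\<integral>y. f (torus_point y) - g y \<partial>cube_measure)"
      unfolding I_def J_def by (rule Bochner_Integration.integral_diff[symmetric]) (rule f_int g_int)+
    also have "\<bar>\<dots>\<bar> \<le> (\<integral>y. \<bar>f (torus_point y) - g y\<bar> \<partial>cube_measure)"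
      by (rule integral_abs_bound)
    also have "\<dots> \<le> (\<integral>y. e / 3 \<partial>(cube_measure :: (real ^ 'd) measure))"
      using g_int f_int by (intro integral_mono less_imp_le g(2)) auto
    finally show ?thesis using prob_space by simp
  qed
  show "\<exists>N0. \<forall>N\<ge>N0. norm ((\<Sum>n\<in>{1..N}. f (torus_point (x n))) / real N - I) < e"
  proof (intro exI[of _ "max N0 1"] allI impI)
    fix N assume N: "max N0 1 \<le> N"
    have "\<bar>(\<Sum>n\<in>{1..N}. f (torus_point (x n))) - (\<Sum>n\<in>{1..N}. g (x n))\<bar> \<le> (\<Sum>n\<in>{1..N}. e / 3)"
      unfolding sum_subtractf[symmetric]
      by (rule order_trans[OF sum_abs sum_mono]) (use g(2) in \<open>auto intro: less_imp_le\<close>)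
    then have "\<bar>((\<Sum>n\<in>{1..N}. f (torus_point (x n))) - (\<Sum>n\<in>{1..N}. g (x n))) / real N\<bar> \<le> e / 3"
      using N by (simp add: field_simps)
    then show "norm ((\<Sum>n\<in>{1..N}. f (torus_point (x n))) / real N - I) < e"
      using N0[of N] IJ N unfolding diff_divide_distrib real_norm_def by linarith
  qed
qed

text \<open>
  The indicator of a closed set is a decreasing limit of the continuous functions
  \<open>max 0 (1 - j * infdist z F)\<close>. One of them has an integral close to the measure of the set, and
  its averages bound the frequency from above. Lower bounds for a box come from applying this
  upper bound to the complement.
\<close>

lemma closed_set_frequency_le:
  fixes F :: "(complex ^ 'd) set"
  assumes weyl: "\<And>h. h \<noteq> (\<lambda>_. 0) \<Longrightarrow> (\<lambda>N. (\<Sum>n\<in>{1..N}. character h (x n)) / of_nat N) \<longlonglongrightarrow> 0"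
    and F: "closed F" "F \<noteq> {}" and "e > 0"
  shows "eventually (\<lambda>N. real (card {n \<in> {1..N}. torus_point (x n) \<in> F}) / real N
            < measure cube_measure {y. torus_point y \<in> F} + e) sequentially"
proof -
  interpret prob_space "cube_measure :: (real ^ 'd) measure" by (rule prob_space_cube_measure)
  define f where "f j z = max 0 (1 - real j * infdist z F)" for j z
  have cont: "continuous_on UNIV (f j)" for j
    unfolding f_def by (intro continuous_intros)
  have [measurable]: "f j \<in> borel_measurable borel" for j
    using cont by (rule borel_measurable_continuous_onI)
  have [measurable]: "F \<in> sets borel" using F(1) by simp
  have f01: "0 \<le> f j z" "f j z \<le> 1" "z \<in> F \<Longrightarrow> f j z = 1" for j z
    by (auto simp: f_def infdist_nonneg)
  have "(\<lambda>j. \<integral>y. f j (torus_point y) \<partial>cube_measure)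
          \<longlonglongrightarrow> (\<integral>y. indicator {y. torus_point y \<in> F} y \<partial>(cube_measure :: (real ^ 'd) measure))"
  proof (rule integral_dominated_convergence[where w = "\<lambda>_. 1"])
    show "AE y in cube_measure. (\<lambda>j. f j (torus_point y)) \<longlonglongrightarrow> indicator {y. torus_point y \<in> F} y"
    proof (rule AE_I2)
      fix y :: "real ^ 'd"
      show "(\<lambda>j. f j (torus_point y)) \<longlonglongrightarrow> indicator {y. torus_point y \<in> F} y"
      proof (cases "torus_point y \<in> F")
        case True
        then show ?thesis using f01(3) by simp
      next
        case False
        then have pos: "infdist (torus_point y) F > 0"
          using infdist_pos_not_in_closed[OF F] by simp
        have "eventually (\<lambda>j. 1 / infdist (torus_point y) F \<le> real j) sequentially"
          using filterlim_real_sequentially unfolding filterlim_at_top by blast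
        then have "eventually (\<lambda>j. f j (torus_point y) = 0) sequentially"
          by eventually_elim (use pos in \<open>simp add: f_def field_simps\<close>)
        then show ?thesis using False by (simp add: tendsto_eventually)
      qed
    qed
  qed (use f01 in auto)
  also have "(\<integral>y. indicator {y. torus_point y \<in> F} y \<partial>(cube_measure :: (real ^ 'd) measure))
      = measure cube_measure {y. torus_point y \<in> F}"
    by simp
  finally have "eventually (\<lambda>j. (\<integral>y. f j (torus_point y) \<partial>cube_measure)
      < measure cube_measure {y. torus_point y \<in> F} + e) sequentially"
    using \<open>e > 0\<close> by (intro order_tendstoD) auto
  then obtain j where j: "(\<integral>y. f j (torus_point y) \<partial>cube_measure) < measure cube_measure {y. torus_point y \<in> F} + e"
    by (meson eventually_happens trivial_limit_sequentially)
  have "(\<lambda>N. (\<Sum>n\<in>{1..N}. f j (torus_point (x n))) / real N) \<longlonglongrightarrow> (\<integral>y. f j (torus_point y) \<partial>cube_measure)"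
    by (rule continuous_averages[OF _ cont]) (rule weyl)
  from order_tendstoD(2)[OF this j] show ?thesis
  proof eventually_elim
    case (elim N)
    have "real (card {n \<in> {1..N}. torus_point (x n) \<in> F}) = (\<Sum>n\<in>{n \<in> {1..N}. torus_point (x n) \<in> F}. f j (torus_point (x n)))"
      using f01(3) by simp
    also have "\<dots> \<le> (\<Sum>n\<in>{1..N}. f j (torus_point (x n)))"
      using f01(1) by (intro sum_mono2) auto
    finally have "real (card {n \<in> {1..N}. torus_point (x n) \<in> F}) / real N \<le> (\<Sum>n\<in>{1..N}. f j (torus_point (x n))) / real N"
      by (rule divide_right_mono) simp
    then show ?case using elim by linarith
  qed
qed

text \<open>
  The torus is covered by the closed sets \<open>C\<close>, the image of the closed box, and \<open>D\<close>, the image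
  of the rest of the cube without the open box. Their measures are at most \<open>V\<close> and \<open>1 - V\<close> for
  the volume \<open>V\<close> of the box, so the upper bounds for their frequencies pin down the frequency of
  \<open>C\<close> from both sides.
\<close>

theorem weyl_criterion:
  fixes x :: "nat \<Rightarrow> real ^ 'd"
  assumes weyl: "\<And>h. h \<noteq> (\<lambda>_. 0) \<Longrightarrow> (\<lambda>N. (\<Sum>n\<in>{1..N}. character h (x n)) / of_nat N) \<longlonglongrightarrow> 0"
  shows "equidistributed_mod_one x"
  unfolding equidistributed_mod_one_def
proof (intro allI impI)
  interpret prob_space "cube_measure :: (real ^ 'd) measure" by (rule prob_space_cube_measure)
  fix a b :: "real ^ 'd"
  assume ab: "\<forall>i. 0 \<le> a $ i \<and> a $ i \<le> b $ i \<and> b $ i \<le> 1"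
  define V where "V = (\<Prod>i\<in>UNIV. b $ i - a $ i)"
  define C where "C = torus_point ` cbox a b"
  define D where "D = torus_point ` (cbox 0 1 - box a b)"
  define fr where "fr S N = real (card {n \<in> {1..N}. torus_point (x n) \<in> S}) / real N" for S N
  have closed: "closed C" "closed D"
    unfolding C_def D_def
    by (intro compact_imp_closed compact_continuous_image continuous_on_torus_point compact_cbox compact_diff open_box)+
  have [measurable]: "C \<in> sets borel" "D \<in> sets borel" using closed by auto
  have "a \<in> cbox a b" using ab by (simp add: mem_box_cart)
  then have "C \<noteq> {}" unfolding C_def by blast
  have "0 \<in> cbox 0 1 - box a b"
    using ab by (auto simp: mem_box_cart not_less)
  then have "D \<noteq> {}" unfolding D_def by blast
  have uniq: "y = z" if "y \<in> box 0 1" "z \<in> cbox 0 1" "torus_point y = torus_point z" for y z :: "real ^ 'd"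
  proof -
    have "y $ i = z $ i" for i
    proof -
      have "y $ i - z $ i \<in> \<int>" using that(3) by (simp add: torus_point_eq_iff)
      moreover have "\<bar>y $ i - z $ i\<bar> < 1"
        using that(1,2)[unfolded mem_box_cart, rule_format, of i] by (simp add: abs_less_iff)
      ultimately show ?thesis using Ints_nonzero_abs_less1[of "y $ i - z $ i"] by auto
    qed
    then show ?thesis by (simp add: vec_eq_iff)
  qed
  have sub: "cbox a b \<subseteq> cbox 0 1"
    using ab by (auto simp: mem_box_cart) (meson order_trans)+
  have "measure cube_measure {y. torus_point y \<in> C} \<le> measure cube_measure (cbox a b)"
  proof (rule finite_measure_mono_AE)
    show "AE y in cube_measure. y \<in> {y. torus_point y \<in> C} \<longrightarrow> y \<in> cbox a b"
      using AE_cube_measure_box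
      by eventually_elim (use uniq sub in \<open>unfold C_def, blast\<close>)
  qed simp
  then have C_le: "measure cube_measure {y. torus_point y \<in> C} \<le> V"
    using ab by (simp add: V_def measure_cube_measure_cbox)
  have "measure cube_measure {y. torus_point y \<in> D} \<le> measure cube_measure (space cube_measure - box a b)"
  proof (rule finite_measure_mono_AE)
    show "AE y in cube_measure. y \<in> {y. torus_point y \<in> D} \<longrightarrow> y \<in> space cube_measure - box a b"
      using AE_cube_measure_box
      by eventually_elim (use uniq in \<open>unfold D_def, auto\<close>)
  qed simp
  then have D_le: "measure cube_measure {y. torus_point y \<in> D} \<le> 1 - V"
    using ab by (subst (asm) prob_compl) (auto simp: V_def measure_cube_measure_box)
  have cover: "1 - fr D N \<le> fr C N" if "N \<ge> 1" for N
  proof -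
    have "torus_point y \<in> C \<or> torus_point y \<in> D" for y
      using torus_point_image_cube[of y] box_subset_cbox[of a b] unfolding C_def D_def by blast
    then have "{1..N} \<subseteq> {n \<in> {1..N}. torus_point (x n) \<in> C} \<union> {n \<in> {1..N}. torus_point (x n) \<in> D}"
      by blast
    then have "card {1..N} \<le> card ({n \<in> {1..N}. torus_point (x n) \<in> C} \<union> {n \<in> {1..N}. torus_point (x n) \<in> D})"
      by (intro card_mono) auto
    also have "\<dots> \<le> card {n \<in> {1..N}. torus_point (x n) \<in> C} + card {n \<in> {1..N}. torus_point (x n) \<in> D}"
      by (rule card_Un_le)
    finally have "real N \<le> real (card {n \<in> {1..N}. torus_point (x n) \<in> C}) + real (card {n \<in> {1..N}. torus_point (x n) \<in> D})"
      by simp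
    then have "real N / real N \<le> (real (card {n \<in> {1..N}. torus_point (x n) \<in> C}) + real (card {n \<in> {1..N}. torus_point (x n) \<in> D})) / real N"
      by (rule divide_right_mono) simp
    then show ?thesis using that by (simp add: fr_def add_divide_distrib)
  qed
  have "fr C \<longlonglongrightarrow> V"
  proof (rule LIMSEQ_I)
    fix e :: real assume "e > 0"
    have fr_le: "eventually (\<lambda>N. fr F N < measure cube_measure {y. torus_point y \<in> F} + e) sequentially"
      if "closed F" "F \<noteq> {}" for F
      unfolding fr_def by (rule closed_set_frequency_le[OF _ that \<open>e > 0\<close>]) (rule weyl)
    have "eventually (\<lambda>N. norm (fr C N - V) < e) sequentially"
      using fr_le[OF closed(1) \<open>C \<noteq> {}\<close>] fr_le[OF closed(2) \<open>D \<noteq> {}\<close>] eventually_ge_at_top[of 1]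
    proof eventually_elim
      case (elim N)
      then show ?case using cover[of N] C_le D_le unfolding real_norm_def by linarith
    qed
    then show "\<exists>N0. \<forall>N\<ge>N0. norm (fr C N - V) < e"
      by (simp add: eventually_sequentially)
  qed
  moreover have "(\<exists>k. (\<forall>i. k $ i \<in> \<int>) \<and> y - k \<in> cbox a b) \<longleftrightarrow> torus_point y \<in> C" for y
  proof
    assume "\<exists>k. (\<forall>i. k $ i \<in> \<int>) \<and> y - k \<in> cbox a b"
    then obtain k where k: "\<forall>i. k $ i \<in> \<int>" "y - k \<in> cbox a b" by blast
    then have "torus_point y = torus_point (y - k)" by (simp add: torus_point_eq_iff)
    then show "torus_point y \<in> C" using k(2) by (simp add: C_def)
  next
    assume "torus_point y \<in> C"
    then obtain z where z: "z \<in> cbox a b" "torus_point y = torus_point z" by (auto simp: C_def)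
    then show "\<exists>k. (\<forall>i. k $ i \<in> \<int>) \<and> y - k \<in> cbox a b"
      by (intro exI[of _ "y - z"]) (simp add: torus_point_eq_iff)
  qed
  ultimately show "(\<lambda>N. real (card {n \<in> {1..N}. \<exists>k. (\<forall>i. k $ i \<in> \<int>) \<and> x n - k \<in> cbox a b}) / real N)
      \<longlonglongrightarrow> (\<Prod>i\<in>UNIV. b $ i - a $ i)"
    by (simp add: fr_def[abs_def] V_def)
qed

section \<open>Averages of weakly correlated random variables\<close>

text \<open>
  Between \<open>k\<^sup>q\<close> and \<open>(k + 1)\<^sup>q\<close> the partial sum changes by at most
  \<open>(k + 1)\<^sup>q - k\<^sup>q\<close>, which is negligible compared with \<open>k\<^sup>q\<close>.
\<close>

lemma averages_tendsto_0_if_power_subsequence: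
  fixes a :: "nat \<Rightarrow> complex"
  assumes bound: "\<And>n. norm (a n) \<le> 1" and "q > 0"
    and sub: "(\<lambda>k. (\<Sum>n\<in>{1..k ^ q}. a n) / of_nat (k ^ q)) \<longlonglongrightarrow> 0"
  shows "(\<lambda>N. (\<Sum>n\<in>{1..N}. a n) / of_nat N) \<longlonglongrightarrow> 0"
proof -
  define S where "S N = (\<Sum>n\<in>{1..N}. a n)" for N
  define k :: "nat \<Rightarrow> nat" where "k N = (GREATEST k. k ^ q \<le> N)" for N
  have bdd: "\<forall>y. y ^ q \<le> N \<longrightarrow> y \<le> N" for N :: nat
  proof (intro allI impI)
    fix y :: nat assume "y ^ q \<le> N"
    then show "y \<le> N"
      using self_le_power[of y q] \<open>q > 0\<close> by (cases "y = 0") auto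
  qed
  have k1: "k N ^ q \<le> N" for N
    unfolding k_def by (rule GreatestI_nat[of _ 0 N]) (use bdd \<open>q > 0\<close> in \<open>auto simp: power_0_left\<close>)
  have k2: "N < Suc (k N) ^ q" for N
  proof (rule ccontr)
    assume "\<not> N < Suc (k N) ^ q"
    then have "Suc (k N) \<le> k N"
      unfolding k_def by (intro Greatest_le_nat[of _ _ N]) (use bdd in auto)
    then show False by simp
  qed
  have k_lim: "filterlim k at_top at_top"
    unfolding filterlim_at_top
  proof
    fix Z
    show "eventually (\<lambda>N. Z \<le> k N) at_top"
      using eventually_ge_at_top[of "Z ^ q"]
    proof eventually_elim
      case (elim N)
      then have "Z ^ q < Suc (k N) ^ q" using k2[of N] by linarith
      then have "Z < Suc (k N)" by (rule power_less_imp_less_base) simp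
      then show ?case by simp
    qed
  qed
  define g where "g k = norm (S (k ^ q) / of_nat (k ^ q)) + ((1 + 1 / real k) ^ q - 1)" for k
  have "(\<lambda>k. norm (S (k ^ q) / of_nat (k ^ q)) + ((1 + 1 / real k) ^ q - 1)) \<longlonglongrightarrow> 0 + ((1 + 0) ^ q - 1)"
    using sub unfolding S_def
    by (intro tendsto_intros tendsto_norm_zero lim_1_over_n) auto
  then have "g \<longlonglongrightarrow> 0" by (simp add: g_def[abs_def])
  then have "(\<lambda>N. g (k N)) \<longlonglongrightarrow> 0" using k_lim by (rule filterlim_compose)
  moreover have "eventually (\<lambda>N. norm (S N / of_nat N) \<le> g (k N)) at_top"
    using eventually_gt_at_top[of 0] eventually_compose_filterlim[OF eventually_gt_at_top[of 0] k_lim]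
  proof eventually_elim
    case (elim N)
    define K where "K = k N ^ q"
    have K: "K > 0" "K \<le> N" using elim k1[of N] by (auto simp: K_def)
    have "S N = S K + (\<Sum>n\<in>{K<..N}. a n)"
      unfolding S_def using K by (subst sum.union_disjoint[symmetric]) (auto intro!: sum.cong)
    moreover have "norm (\<Sum>n\<in>{K<..N}. a n) \<le> (\<Sum>n\<in>{K<..N}. 1)"
      by (rule sum_norm_le) (use bound in auto)
    ultimately have "norm (S N) \<le> norm (S K) + (real N - real K)"
      using norm_triangle_ineq[of "S K" "\<Sum>n\<in>{K<..N}. a n"] K by (simp add: of_nat_diff)
    then have "norm (S N) / real N \<le> (norm (S K) + (real N - real K)) / real K"
      using K by (intro frac_le) auto
    also have "\<dots> = norm (S K) / real K + (real N / real K - 1)"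
      using K by (simp add: field_simps)
    also have "real N / real K \<le> real (Suc (k N) ^ q) / real K"
      using k2[of N] by (intro divide_right_mono of_nat_mono) auto
    also have "real (Suc (k N) ^ q) / real K = (1 + 1 / real (k N)) ^ q"
    proof -
      have "1 + 1 / real (k N) = real (Suc (k N)) / real (k N)"
        using elim by (simp add: add_divide_distrib)
      then show ?thesis by (simp only: K_def of_nat_power power_divide)
    qed
    finally show ?case by (simp add: g_def norm_divide norm_power K_def)
  qed
  ultimately have "(\<lambda>N. S N / of_nat N) \<longlonglongrightarrow> 0"
    by (rule Lim_null_comparison[rotated])
  then show ?thesis by (simp add: S_def)
qed

text \<open>
  Expand the square into correlations. The three summands account for the diagonal, for the pairs
  with both indices at most \<open>L\<close>, which are estimated trivially, and for all other pairs, whose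
  larger index exceeds \<open>L\<close>. Cutting at a free parameter \<open>L\<close> avoids evaluating the sum of
  \<open>max m n powr (- \<alpha>)\<close>.
\<close>

lemma (in prob_space) second_moment_le:
  fixes X :: "nat \<Rightarrow> 'a \<Rightarrow> complex"
  assumes [measurable]: "\<And>n. X n \<in> borel_measurable M"
    and bound: "\<And>n x. norm (X n x) \<le> 1"
    and corr: "\<And>m n. 1 \<le> m \<Longrightarrow> m < n \<Longrightarrow> norm (expectation (\<lambda>x. X n x * cnj (X m x))) \<le> C * real n powr (- \<alpha>)"
    and "\<alpha> > 0" "C \<ge> 0" "L \<ge> 1"
  shows "expectation (\<lambda>x. (norm (\<Sum>n\<in>{1..N}. X n x))\<^sup>2) \<le> real N + (real L)\<^sup>2 + C * real L powr (- \<alpha>) * (real N)\<^sup>2"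
proof -
  define c where "c m n = expectation (\<lambda>x. X m x * cnj (X n x))" for m n
  define I :: "nat \<Rightarrow> real" where "I m = (if m \<le> L then 1 else 0)" for m
  have [measurable]: "(\<lambda>x. cnj (X n x)) \<in> borel_measurable M" for n
    by (rule borel_measurable_continuous_on[of cnj]) (auto intro: continuous_intros)
  have [simp]: "integrable M (\<lambda>x. X m x * cnj (X n x))" for m n
    by (rule integrable_const_bound[where B = 1])
      (auto simp: norm_mult intro!: mult_le_one bound)
  have c_sym: "c m n = cnj (c n m)" for m n
  proof -
    have "cnj (c n m) = expectation (\<lambda>x. cnj (X n x * cnj (X m x)))"
      unfolding c_def by (rule Bochner_Integration.integral_cnj[symmetric])
    then show ?thesis by (simp add: c_def mult.commute)
  qed
  have c_le1: "norm (c m n) \<le> 1" for m n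
  proof -
    have "norm (c m n) \<le> expectation (\<lambda>x. norm (X m x * cnj (X n x)))"
      unfolding c_def by (rule integral_norm_bound)
    also have "\<dots> \<le> expectation (\<lambda>x. 1)"
      by (intro integral_mono integrable_norm) (auto simp: norm_mult intro!: mult_le_one bound)
    finally show ?thesis by (simp add: prob_space)
  qed
  have c_far: "norm (c m n) \<le> C * real L powr (- \<alpha>)" if "m < n" "1 \<le> m" "L < n" for m n
  proof -
    have "norm (c m n) \<le> C * real n powr (- \<alpha>)"
      using corr[of m n] that c_sym[of m n] by (simp add: c_def)
    also have "real n powr (- \<alpha>) \<le> real L powr (- \<alpha>)"
      using that \<open>\<alpha> > 0\<close> \<open>L \<ge> 1\<close> by (intro powr_mono2') auto
    finally show ?thesis using \<open>C \<ge> 0\<close> by (simp add: mult_left_mono)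
  qed
  have c_bound: "norm (c m n) \<le> (if m = n then 1 else 0) + I m * I n + C * real L powr (- \<alpha>)"
    if "1 \<le> m" "1 \<le> n" for m n
  proof (cases "m = n \<or> m \<le> L \<and> n \<le> L")
    case True
    then have "1 \<le> (if m = n then 1 else 0) + I m * I n"
      by (auto simp: I_def)
    moreover have "0 \<le> C * real L powr (- \<alpha>)"
      using \<open>C \<ge> 0\<close> by simp
    ultimately show ?thesis using c_le1[of m n] by linarith
  next
    case False
    then consider "m < n" "L < n" | "n < m" "L < m" by linarith
    then have "norm (c m n) \<le> C * real L powr (- \<alpha>)"
    proof cases
      case 2
      then show ?thesis using c_far[of n m] that c_sym[of m n] by simp
    qed (use c_far that in auto)
    then show ?thesis using False by (simp add: I_def)
  qed
  have "complex_of_real (expectation (\<lambda>x. (norm (\<Sum>n\<in>{1..N}. X n x))\<^sup>2))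
        = expectation (\<lambda>x. complex_of_real ((norm (\<Sum>n\<in>{1..N}. X n x))\<^sup>2))"
    by (rule integral_complex_of_real[symmetric])
  also have "\<dots> = expectation (\<lambda>x. \<Sum>m\<in>{1..N}. \<Sum>n\<in>{1..N}. X m x * cnj (X n x))"
    by (simp only: complex_norm_square cnj_sum sum_product)
  also have "\<dots> = (\<Sum>m\<in>{1..N}. \<Sum>n\<in>{1..N}. c m n)"
    unfolding c_def by (subst Bochner_Integration.integral_sum) (auto simp: Bochner_Integration.integral_sum)
  finally have eq: "complex_of_real (expectation (\<lambda>x. (norm (\<Sum>n\<in>{1..N}. X n x))\<^sup>2))
        = (\<Sum>m\<in>{1..N}. \<Sum>n\<in>{1..N}. c m n)" .
  have "expectation (\<lambda>x. (norm (\<Sum>n\<in>{1..N}. X n x))\<^sup>2) \<le> norm (\<Sum>m\<in>{1..N}. \<Sum>n\<in>{1..N}. c m n)"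
    unfolding eq[symmetric] norm_of_real by simp
  also have "\<dots> \<le> (\<Sum>m\<in>{1..N}. \<Sum>n\<in>{1..N}. (if m = n then 1 else 0) + I m * I n + C * real L powr (- \<alpha>))"
    by (intro sum_norm_le) (use c_bound in auto)
  also have "\<dots> = (\<Sum>m\<in>{1..N}. \<Sum>n\<in>{1..N}. (if m = n then 1 else 0)) + (\<Sum>m\<in>{1..N}. I m)\<^sup>2
                   + C * real L powr (- \<alpha>) * (real N)\<^sup>2"
    by (simp only: sum.distrib power2_eq_square sum_product) simp
  also have "(\<Sum>m\<in>{1..N}. \<Sum>n\<in>{1..N}. (if m = n then 1 else 0)) = real N"
    by simp
  also have "(\<Sum>m\<in>{1..N}. I m)\<^sup>2 \<le> (real L)\<^sup>2"
  proof (rule power_mono)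
    have "(\<Sum>m\<in>{1..N}. I m) = (\<Sum>m\<in>{m\<in>{1..N}. m \<le> L}. 1)"
      unfolding I_def by (simp only: sum.inter_filter finite_atLeastAtMost)
    also have "\<dots> \<le> (\<Sum>m\<in>{1..L}. 1)"
      by (intro sum_mono2) auto
    finally show "(\<Sum>m\<in>{1..N}. I m) \<le> real L" by simp
    show "0 \<le> (\<Sum>m\<in>{1..N}. I m)"
      by (rule sum_nonneg) (simp add: I_def)
  qed
  finally show ?thesis by simp
qed

text \<open>
  By monotone convergence the series of the \<open>f k\<close> has a finite expectation, so it converges
  almost surely and its terms tend to \<open>0\<close>.
\<close>

lemma (in prob_space) AE_tendsto_0_if_summable_expectation:
  fixes f :: "nat \<Rightarrow> 'a \<Rightarrow> real"
  assumes [measurable]: "\<And>k. integrable M (f k)"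
    and nonneg: "\<And>k x. f k x \<ge> 0"
    and sum: "summable (\<lambda>k. expectation (f k))"
  shows "AE x in M. (\<lambda>k. f k x) \<longlonglongrightarrow> 0"
proof -
  have "(\<integral>\<^sup>+x. (\<Sum>k. ennreal (f k x)) \<partial>M) = (\<Sum>k. \<integral>\<^sup>+x. ennreal (f k x) \<partial>M)"
    by (rule nn_integral_suminf) simp
  also have "\<dots> = (\<Sum>k. ennreal (expectation (f k)))"
    using assms by (simp add: nn_integral_eq_integral)
  also have "\<dots> = ennreal (\<Sum>k. expectation (f k))"
    using sum nonneg by (intro suminf_ennreal2) (auto intro: Bochner_Integration.integral_nonneg)
  finally have "(\<integral>\<^sup>+x. (\<Sum>k. ennreal (f k x)) \<partial>M) \<noteq> \<infinity>" by simp
  then have "AE x in M. (\<Sum>k. ennreal (f k x)) \<noteq> \<infinity>"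
    by (intro nn_integral_noteq_infinite) simp_all
  then show ?thesis
  proof eventually_elim
    case (elim x)
    then have "summable (\<lambda>k. f k x)"
      by (intro summable_suminf_not_top) (use nonneg in auto)
    then show ?case by (rule summable_LIMSEQ_zero)
  qed
qed

text \<open>
  For \<open>N = k\<^sup>2\<^sup>p\<close> and the cut-off \<open>L = k\<^sup>p\<close> the second moment of the average is at most
  \<open>2 k\<^sup>-\<^sup>2\<^sup>p + C k\<^sup>-\<^sup>p\<^sup>\<alpha>\<close>, which is summable over \<open>k\<close> as soon as \<open>p \<alpha> \<ge> 2\<close>.
\<close>

lemma (in prob_space) AE_averages_tendsto_0:
  fixes X :: "nat \<Rightarrow> 'a \<Rightarrow> complex"
  assumes [measurable]: "\<And>n. X n \<in> borel_measurable M"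
    and bound: "\<And>n x. norm (X n x) \<le> 1"
    and corr: "\<And>m n. 1 \<le> m \<Longrightarrow> m < n \<Longrightarrow> norm (expectation (\<lambda>x. X n x * cnj (X m x))) \<le> C * real n powr (- \<alpha>)"
    and "\<alpha> > 0" "C \<ge> 0"
  shows "AE x in M. (\<lambda>N. (\<Sum>n\<in>{1..N}. X n x) / of_nat N) \<longlonglongrightarrow> 0"
proof -
  obtain p0 :: nat where "2 / \<alpha> < real p0"
    using reals_Archimedean2 by blast
  then obtain p :: nat where p: "2 / \<alpha> < real p" "1 \<le> p"
    by (intro that[of "Suc p0"]) auto
  define S where "S N x = (\<Sum>n\<in>{1..N}. X n x)" for N x
  define f where "f k x = (norm (S (k ^ (2 * p)) x / of_nat (k ^ (2 * p))))\<^sup>2" for k x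
  have norm_S: "norm (S N x) \<le> real N" for N x
  proof -
    have "norm (S N x) \<le> (\<Sum>n\<in>{1..N}. 1)"
      unfolding S_def by (rule sum_norm_le) (rule bound)
    then show ?thesis by simp
  qed
  have meas[measurable]: "S N \<in> borel_measurable M" for N
    unfolding S_def[abs_def] by measurable
  have f_int: "integrable M (f k)" for k
  proof (rule integrable_const_bound[where B = 1])
    have le1: "norm (S N x / of_nat N) \<le> 1" for N x
      using norm_S[of N x] by (cases "N = 0") (auto simp: norm_divide)
    have "norm (f k x) \<le> 1" for x
      unfolding f_def using power_le_one[OF norm_ge_zero le1, of "k ^ (2 * p)" x 2] by simp
    then show "AE x in M. norm (f k x) \<le> 1" by simp
    show "f k \<in> borel_measurable M"
      unfolding f_def[abs_def] by measurable
  qed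
  have f_le: "expectation (f k) \<le> (2 + C) * inverse (real k ^ 2)" if "k \<ge> 1" for k
  proof -
    define N where "N = k ^ (2 * p)"
    have N: "real N = (real k ^ p)\<^sup>2" "real N > 0"
      using that by (auto simp: N_def power_mult[symmetric] mult.commute)
    have kp: "real k ^ 2 \<le> real N"
      using that p unfolding N_def of_nat_power by (intro power_increasing) auto
    have "expectation (f k) = expectation (\<lambda>x. (norm (S N x))\<^sup>2) / (real N)\<^sup>2"
      by (simp add: f_def[abs_def] N_def norm_divide power_divide norm_power)
    also have "\<dots> \<le> (real N + (real (k ^ p))\<^sup>2 + C * real (k ^ p) powr (- \<alpha>) * (real N)\<^sup>2) / (real N)\<^sup>2"
      unfolding S_def using assms that
      by (intro divide_right_mono second_moment_le) auto
    also have "\<dots> = 2 / real N + C * real (k ^ p) powr (- \<alpha>)"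
      using N(2) unfolding of_nat_power N(1)[symmetric] by (simp add: field_simps power2_eq_square)
    also have "\<dots> \<le> 2 * inverse (real k ^ 2) + C * inverse (real k ^ 2)"
    proof (intro add_mono mult_left_mono)
      show "2 / real N \<le> 2 * inverse (real k ^ 2)"
        using le_imp_inverse_le[OF kp] that by (simp add: divide_inverse)
      have "real (k ^ p) powr (- \<alpha>) = real k powr (- (real p * \<alpha>))"
        using that by (simp add: powr_realpow[symmetric] powr_powr)
      also have "\<dots> \<le> real k powr (- 2)"
        using that p \<open>\<alpha> > 0\<close> by (intro powr_mono) (auto simp: field_simps)
      also have "real k powr (- 2) = inverse (real k ^ 2)"
        using that by (simp add: powr_minus)
      finally show "real (k ^ p) powr (- \<alpha>) \<le> inverse (real k ^ 2)" .
    qed fact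
    finally show ?thesis by (simp add: algebra_simps)
  qed
  have "summable (\<lambda>k. expectation (f k))"
  proof (rule summable_comparison_test_ev)
    show "eventually (\<lambda>k. norm (expectation (f k)) \<le> (2 + C) * inverse (real k ^ 2)) at_top"
      using eventually_ge_at_top[of 1]
      by eventually_elim (use f_le in \<open>auto simp: f_def[abs_def]\<close>)
    show "summable (\<lambda>k. (2 + C) * inverse (real k ^ 2))"
      by (intro summable_mult inverse_power_summable) simp
  qed
  moreover have "f k x \<ge> 0" for k x
    by (simp add: f_def)
  ultimately have "AE x in M. (\<lambda>k. f k x) \<longlonglongrightarrow> 0"
    by (intro AE_tendsto_0_if_summable_expectation[OF f_int])
  then show ?thesis
  proof eventually_elim
    case (elim x)
    then have "(\<lambda>k. sqrt (f k x)) \<longlonglongrightarrow> sqrt 0" by (intro tendsto_intros)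
    then have "(\<lambda>k. norm (S (k ^ (2 * p)) x / of_nat (k ^ (2 * p)))) \<longlonglongrightarrow> 0"
      by (simp only: f_def real_sqrt_abs abs_norm_cancel real_sqrt_zero)
    then have lim: "(\<lambda>k. S (k ^ (2 * p)) x / of_nat (k ^ (2 * p))) \<longlonglongrightarrow> 0"
      by (rule tendsto_norm_zero_cancel)
    show ?case
    proof (rule averages_tendsto_0_if_power_subsequence)
      show "norm (X n x) \<le> 1" for n by (rule bound)
      show "0 < 2 * p" using p(2) by simp
      show "(\<lambda>k. (\<Sum>n\<in>{1..k ^ (2 * p)}. X n x) / of_nat (k ^ (2 * p))) \<longlonglongrightarrow> 0"
        using lim unfolding S_def .
    qed
  qed
qed

section \<open>Growth of the frequencies\<close>

lemma smallest_singular_value_mult_norm_le: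
  fixes B :: "real ^ 'd ^ 'd"
  shows "smallest_singular_value B * norm x \<le> norm (B *v x)"
proof (cases "x = 0")
  case False
  define u where "u = inverse (norm x) *\<^sub>R x"
  have "norm u = 1"
    using False by (simp add: u_def)
  moreover have "bdd_below {norm (B *v x) | x. norm x = 1}"
    by (rule bdd_belowI[of _ 0]) auto
  ultimately have "smallest_singular_value B \<le> norm (B *v u)"
    unfolding smallest_singular_value_def by (intro cInf_lower) auto
  also have "norm (B *v u) = norm (B *v x) / norm x"
    unfolding u_def matrix_vector_mult_scaleR norm_scaleR by (simp add: divide_inverse mult.commute)
  finally show ?thesis
    using False by (simp add: field_simps)
qed simp

text \<open>
  A square matrix and its transpose have the same smallest singular value. For \<open>y = B z\<close>, the
  bound for the transpose is Cauchy-Schwarz: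
  \<open>\<bar>y\<bar>\<^sup>2 = \<langle>B\<^sup>T y, z\<rangle> \<le> \<bar>B\<^sup>T y\<bar> \<bar>z\<bar>\<close>, where \<open>\<bar>z\<bar> \<le> \<bar>y\<bar> / k\<close>.
\<close>

lemma norm_vector_matrix_mult_ge:
  fixes B :: "real ^ 'd ^ 'd"
  assumes B: "\<And>x. k * norm x \<le> norm (B *v x)" and "k > 0"
  shows "k * norm y \<le> norm (y v* B)"
proof (cases "y = 0")
  case False
  have "x = x'" if "B *v x = B *v x'" for x x'
  proof -
    have "k * norm (x - x') \<le> 0"
      using B[of "x - x'"] that by (simp add: matrix_vector_mult_diff_distrib)
    then show ?thesis using \<open>k > 0\<close> by (simp add: mult_le_0_iff)
  qed
  then have "inj ((*v) B)" by (auto intro: injI)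
  then have "surj ((*v) B)"
    by (simp add: linear_injective_imp_surjective)
  then obtain z where z: "y = B *v z" by (metis surjD)
  have "k * norm y * norm y = k * (y \<bullet> (B *v z))"
    using z by (simp add: power2_norm_eq_inner[symmetric] power2_eq_square)
  also have "\<dots> = k * ((y v* B) \<bullet> z)"
    by (simp add: dot_lmul_matrix)
  also have "\<dots> \<le> k * (norm (y v* B) * norm z)"
    using \<open>k > 0\<close> norm_cauchy_schwarz by (intro mult_left_mono) auto
  also have "\<dots> = norm (y v* B) * (k * norm z)"
    by simp
  also have "\<dots> \<le> norm (y v* B) * norm y"
    using B[of z] z by (intro mult_left_mono) auto
  finally show ?thesis using False by simp
qed simp

text \<open>
  A kernel vector would be an eigenvector for the eigenvalue \<open>0\<close>, which is not of modulus greater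
  than \<open>1\<close>.
\<close>

lemma expanding_integral_matrix_invertible:
  fixes A :: "real ^ 'd ^ 'd"
  assumes "expanding_integral_matrix A"
  shows "invertible A"
proof (rule ccontr)
  assume "\<not> invertible A"
  then obtain v where v: "v \<noteq> 0" "A *v v = 0"
    using invertible_left_inverse matrix_left_invertible_ker by metis
  define w :: "complex ^ 'd" where "w = (\<chi> i. complex_of_real (v $ i))"
  have "w \<noteq> 0"
    using v(1) by (auto simp: w_def vec_eq_iff)
  moreover have "(\<chi> i j. complex_of_real (A $ i $ j)) *v w = 0 *s w"
  proof -
    have "(\<Sum>j\<in>UNIV. complex_of_real (A $ i $ j) * complex_of_real (v $ j)) = 0" for i
    proof -
      have "(\<Sum>j\<in>UNIV. A $ i $ j * v $ j) = 0"
        using v(2) by (simp add: matrix_vector_mult_def vec_eq_iff)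
      then have "complex_of_real (\<Sum>j\<in>UNIV. A $ i $ j * v $ j) = 0" by simp
      then show ?thesis by simp
    qed
    then show ?thesis
      by (simp add: w_def matrix_vector_mult_def vec_eq_iff)
  qed
  ultimately have "eigenvalue (\<chi> i j. complex_of_real (A $ i $ j)) 0"
    unfolding eigenvalue_def by blast
  then show False
    using assms unfolding expanding_integral_matrix_def by fastforce
qed

lemma matrix_inv_mult_left:
  assumes "invertible A"
  shows "matrix_inv A ** A = mat 1"
proof -
  from assms obtain B where "A ** B = mat 1 \<and> B ** A = mat 1"
    unfolding invertible_def by blast
  then show ?thesis
    unfolding matrix_inv_def by (rule someI2) simp
qed

lemma singular_value_growth:
  fixes A :: "nat \<Rightarrow> real ^ 'd ^ 'd"
  assumes inv: "\<And>n. n \<ge> 1 \<Longrightarrow> invertible (A n)"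
    and growth: "\<And>n. n \<ge> 1 \<Longrightarrow> smallest_singular_value (A (Suc n) ** matrix_inv (A n)) \<ge> K"
    and "K > 0" "1 \<le> m"
  shows "\<exists>D. A (m + k) = D ** A m \<and> (\<forall>x. K ^ k * norm x \<le> norm (D *v x))"
proof (induction k)
  case 0
  show ?case by (intro exI[of _ "mat 1"]) (simp add: matrix_mul_lid)
next
  case (Suc k)
  then obtain D where D: "A (m + k) = D ** A m" "\<And>x. K ^ k * norm x \<le> norm (D *v x)"
    by blast
  define B where "B = A (Suc (m + k)) ** matrix_inv (A (m + k))"
  have "A (Suc (m + k)) = B ** A (m + k)"
    unfolding B_def using matrix_inv_mult_left[OF inv[of "m + k"]] \<open>1 \<le> m\<close>
    by (simp add: matrix_mul_assoc[symmetric])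
  then have "A (m + Suc k) = (B ** D) ** A m"
    using D(1) by (simp add: matrix_mul_assoc)
  moreover have "K ^ Suc k * norm x \<le> norm ((B ** D) *v x)" for x
  proof -
    have "K ^ Suc k * norm x = K * (K ^ k * norm x)" by simp
    also have "\<dots> \<le> K * norm (D *v x)"
      using D(2) \<open>K > 0\<close> by (intro mult_left_mono) auto
    also have "\<dots> \<le> smallest_singular_value B * norm (D *v x)"
      using growth[of "m + k"] \<open>1 \<le> m\<close> by (intro mult_right_mono) (auto simp: B_def)
    also have "\<dots> \<le> norm (B *v (D *v x))"
      by (rule smallest_singular_value_mult_norm_le)
    finally show ?thesis by (simp add: matrix_vector_mul_assoc)
  qed
  ultimately show ?case by blast
qed

text \<open>
  With \<open>A n = D ** A m\<close>, the difference is \<open>(h v* D - h) v* A m\<close>. The inner vector has norm at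
  least \<open>(K\<^sup>n\<^sup>-\<^sup>m - 1) \<bar>h\<bar>\<close>, which is at least \<open>(1 - 1 / K) K\<^sup>n\<^sup>-\<^sup>m \<bar>h\<bar>\<close> because
  \<open>m < n\<close>, and \<open>A m\<close> expands by at least \<open>s K\<^sup>m\<^sup>-\<^sup>1\<close>, where \<open>s\<close> is a lower bound for the
  smallest singular value of \<open>A 1\<close>.
\<close>

lemma frequency_gap:
  fixes A :: "nat \<Rightarrow> real ^ 'd ^ 'd" and h :: "real ^ 'd"
  assumes inv: "\<And>n. n \<ge> 1 \<Longrightarrow> invertible (A n)"
    and growth: "\<And>n. n \<ge> 1 \<Longrightarrow> smallest_singular_value (A (Suc n) ** matrix_inv (A n)) \<ge> K"
    and "K > 1" "h \<noteq> 0"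
  shows "\<exists>c>0. \<forall>m n. 1 \<le> m \<and> m < n \<longrightarrow> c * K ^ n \<le> norm (h v* A n - h v* A m)"
proof -
  have "inj ((*v) (A 1))"
    using inv[of 1] by (intro inj_matrix_vector_mult) simp
  then obtain s where s: "s > 0" "\<And>x. s * norm x \<le> norm (A 1 *v x)"
    using linear_inj_bounded_below_pos[OF matrix_vector_mul_linear] by metis
  define c where "c = s / K * (1 - 1 / K) * norm h"
  have "c > 0" using s \<open>K > 1\<close> \<open>h \<noteq> 0\<close> by (simp add: c_def)
  moreover have "c * K ^ n \<le> norm (h v* A n - h v* A m)" if "1 \<le> m" "m < n" for m n
  proof -
    define k where "k = n - Suc m"
    have n: "n = m + Suc k" using that by (simp add: k_def)
    define m' where "m' = m - 1"
    have m': "m = 1 + m'" using that(1) by (simp add: m'_def)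
    have "\<exists>D. A n = D ** A m \<and> (\<forall>x. K ^ Suc k * norm x \<le> norm (D *v x))"
      unfolding n by (rule singular_value_growth) (use that \<open>K > 1\<close> in \<open>auto simp: inv growth\<close>)
    then obtain D where D: "A n = D ** A m" "\<And>x. K ^ Suc k * norm x \<le> norm (D *v x)"
      by blast
    have "\<exists>E. A m = E ** A 1 \<and> (\<forall>x. K ^ m' * norm x \<le> norm (E *v x))"
      unfolding m' by (rule singular_value_growth) (use \<open>K > 1\<close> in \<open>auto simp: inv growth\<close>)
    then obtain E where E: "A m = E ** A 1" "\<And>x. K ^ m' * norm x \<le> norm (E *v x)"
      by blast
    have "K ^ Suc k * norm h \<le> norm (h v* D)"
      using D(2) \<open>K > 1\<close> by (intro norm_vector_matrix_mult_ge) auto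
    moreover have "K ^ k * norm h \<ge> norm h"
      using one_le_power[of K k] \<open>K > 1\<close> mult_right_mono[of 1 "K ^ k" "norm h"] by simp
    moreover have "norm (h v* D) - norm h \<le> norm (h v* D - h)"
      by (rule norm_triangle_ineq2)
    ultimately have "(K ^ Suc k - K ^ k) * norm h \<le> norm (h v* D - h)"
      by (simp add: algebra_simps)
    moreover have "c * K ^ n = s * K ^ m' * ((K ^ Suc k - K ^ k) * norm h)"
      using \<open>K > 1\<close> by (simp add: c_def n m' power_add field_simps)
    ultimately have "c * K ^ n \<le> s * K ^ m' * norm (h v* D - h)"
      using s(1) \<open>K > 1\<close> by (simp add: mult_left_mono)
    also have "\<dots> \<le> norm ((h v* D - h) v* A m)"
    proof (rule norm_vector_matrix_mult_ge)
      fix x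
      have "s * K ^ m' * norm x \<le> K ^ m' * norm (A 1 *v x)"
        using s(2)[of x] \<open>K > 1\<close> by (simp add: mult.commute mult.left_commute)
      also have "\<dots> \<le> norm (A m *v x)"
        using E(2)[of "A 1 *v x"] by (simp add: E(1) matrix_vector_mul_assoc)
      finally show "s * K ^ m' * norm x \<le> norm (A m *v x)" .
    qed (use s(1) \<open>K > 1\<close> in auto)
    also have "(h v* D - h) v* A m = h v* A n - h v* A m"
      by (simp add: D(1) vector_matrix_mult_diff_distrib vector_matrix_mul_assoc)
    finally show ?thesis .
  qed
  ultimately show ?thesis by blast
qed

section \<open>Equidistribution almost everywhere\<close>

text \<open>
  The logarithm of a frequency difference of size \<open>c K\<^sup>n\<close> is at least \<open>n ln K / 2\<close> once \<open>n\<close> is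
  large; for the finitely many smaller \<open>n\<close> the trivial bound \<open>1\<close> for the Fourier transform is
  absorbed into the constant.
\<close>

lemma polylog_fourier_decay_along_gaps:
  fixes \<mu> :: "(real ^ 'd) measure" and t :: "nat \<Rightarrow> real ^ 'd"
  assumes "prob_space \<mu>" and decay: "polylog_fourier_decay \<mu>"
    and "c > 0" "K > 1"
    and gap: "\<And>m n. 1 \<le> m \<Longrightarrow> m < n \<Longrightarrow> c * K ^ n \<le> norm (t n - t m)"
  shows "\<exists>C \<alpha>. C \<ge> 0 \<and> \<alpha> > 0 \<and>
    (\<forall>m n. 1 \<le> m \<and> m < n \<longrightarrow> norm (fourier_transform \<mu> (t m - t n)) \<le> C * real n powr (- \<alpha>))"
proof -
  interpret prob_space \<mu> by fact
  obtain \<alpha> where "\<alpha> > 0" and \<alpha>: "(\<lambda>t. norm (fourier_transform \<mu> t))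
      \<in> O[filtercomap infnorm at_top](\<lambda>t. ln (infnorm t) powr (- \<alpha>))"
    using decay unfolding polylog_fourier_decay_def by blast
  obtain C0 where "C0 > 0" and C0: "eventually (\<lambda>t. norm (norm (fourier_transform \<mu> t))
      \<le> C0 * norm (ln (infnorm t) powr (- \<alpha>))) (filtercomap infnorm at_top)"
    using landau_o.bigE[OF \<alpha>] by blast
  from C0 obtain T where T: "\<And>t. infnorm t \<ge> T \<Longrightarrow>
      norm (fourier_transform \<mu> t) \<le> C0 * ln (infnorm t) powr (- \<alpha>)"
    unfolding eventually_filtercomap_at_top_linorder by auto
  define c' where "c' = c / sqrt (real DIM(real ^ 'd))"
  have "c' > 0" using \<open>c > 0\<close> by (simp add: c'_def)
  have gap': "c' * K ^ n \<le> infnorm (t m - t n)" if "1 \<le> m" "m < n" for m n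
  proof -
    have "c * K ^ n \<le> norm (t m - t n)"
      using gap[OF that] by (simp add: norm_minus_commute)
    also have "\<dots> \<le> sqrt (real DIM(real ^ 'd)) * infnorm (t m - t n)"
      by (rule norm_le_infnorm)
    finally show ?thesis by (simp add: c'_def field_simps)
  qed
  \<comment> \<open>Half of the growth rate \<open>ln K\<close>: the other half absorbs the constant \<open>c'\<close>.\<close>
  define b where "b = ln K / 2"
  have "b > 0" using \<open>K > 1\<close> by (simp add: b_def)
  have "filterlim (\<lambda>n. c' * K ^ n) at_top sequentially"
    using \<open>c' > 0\<close> \<open>K > 1\<close> by real_asymp
  then have "eventually (\<lambda>n. T \<le> c' * K ^ n) sequentially"
    unfolding filterlim_at_top by blast
  moreover have "eventually (\<lambda>n. exp (b * real n) \<le> c' * K ^ n) sequentially"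
  proof -
    have "eventually (\<lambda>n. - ln c' / b \<le> real n) sequentially"
      using filterlim_real_sequentially unfolding filterlim_at_top by blast
    then show ?thesis
    proof eventually_elim
      case (elim n)
      then have "b * real n \<le> ln c' + real n * ln K"
        using \<open>b > 0\<close> unfolding b_def by (simp add: field_simps)
      then have "exp (b * real n) \<le> exp (ln c' + real n * ln K)"
        by simp
      also have "\<dots> = c' * K ^ n"
        using \<open>c' > 0\<close> \<open>K > 1\<close> by (simp add: exp_add exp_of_nat_mult)
      finally show ?case .
    qed
  qed
  ultimately have "eventually (\<lambda>n. T \<le> c' * K ^ n \<and> exp (b * real n) \<le> c' * K ^ n) sequentially"
    by eventually_elim simp
  then obtain n0 where n0: "\<And>n. n \<ge> n0 \<Longrightarrow> T \<le> c' * K ^ n \<and> exp (b * real n) \<le> c' * K ^ n"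
    unfolding eventually_sequentially by blast
  define C where "C = max (C0 * b powr (- \<alpha>)) (real n0 powr \<alpha>)"
  have "norm (fourier_transform \<mu> (t m - t n)) \<le> C * real n powr (- \<alpha>)" if "1 \<le> m" "m < n" for m n
  proof (cases "n \<ge> n0")
    case True
    define s where "s = infnorm (t m - t n)"
    have "T \<le> s" "exp (b * real n) \<le> s"
      using gap'[OF that] n0[OF True] unfolding s_def by linarith+
    moreover have "b * real n > 0" using \<open>b > 0\<close> that by simp
    ultimately have ln: "b * real n \<le> ln s"
      by (metis exp_gt_zero ln_exp ln_le_cancel_iff order_less_le_trans)
    have "norm (fourier_transform \<mu> (t m - t n)) \<le> C0 * ln s powr (- \<alpha>)"
      using T \<open>T \<le> s\<close> unfolding s_def by blast
    also have "\<dots> \<le> C0 * (b * real n) powr (- \<alpha>)"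
      using ln \<open>b * real n > 0\<close> \<open>C0 > 0\<close> \<open>\<alpha> > 0\<close> by (intro mult_left_mono powr_mono2') auto
    also have "\<dots> = C0 * b powr (- \<alpha>) * real n powr (- \<alpha>)"
      using \<open>b > 0\<close> by (simp add: powr_mult)
    also have "\<dots> \<le> C * real n powr (- \<alpha>)"
      unfolding C_def by (intro mult_right_mono) auto
    finally show ?thesis .
  next
    case False
    have "norm (fourier_transform \<mu> (t m - t n)) \<le> (\<integral>x. norm (exp (- (2 * complex_of_real pi * \<i> * complex_of_real ((t m - t n) \<bullet> x)))) \<partial>\<mu>)"
      unfolding fourier_transform_def by (rule integral_norm_bound)
    also have "\<dots> = 1" using prob_space by simp
    also have "1 = real n powr \<alpha> * real n powr (- \<alpha>)"
      using that by (simp add: powr_minus)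
    also have "\<dots> \<le> C * real n powr (- \<alpha>)"
    proof (rule mult_right_mono)
      have "real n powr \<alpha> \<le> real n0 powr \<alpha>"
        using False \<open>\<alpha> > 0\<close> by (intro powr_mono2) auto
      then show "real n powr \<alpha> \<le> C" by (simp add: C_def)
    qed simp
    finally show ?thesis .
  qed
  moreover have "C \<ge> 0" by (simp add: C_def le_max_iff_disj)
  ultimately show ?thesis using \<open>\<alpha> > 0\<close> by blast
qed

theorem theorem1p7:
  fixes \<mu> :: "(real ^ 'd) measure"
    and A :: "nat \<Rightarrow> real ^ 'd ^ 'd"
    and K :: real
  assumes "prob_space \<mu>"
    and "sets \<mu> = sets borel"
    and "polylog_fourier_decay \<mu>"
    and "\<And>n. n \<ge> 1 \<Longrightarrow> expanding_integral_matrix (A n)"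
    and "K > 1"
    and "\<And>n. n \<ge> 1 \<Longrightarrow> smallest_singular_value (A (Suc n) ** matrix_inv (A n)) \<ge> K"
  shows "AE x in \<mu>. equidistributed_mod_one (\<lambda>n. A n *v x)"
proof -
  interpret prob_space \<mu> by fact
  have "AE x in \<mu>. (\<lambda>N. (\<Sum>n\<in>{1..N}. character h (A n *v x)) / of_nat N) \<longlonglongrightarrow> 0"
    if "h \<noteq> (\<lambda>_. 0)" for h :: "'d \<Rightarrow> int"
  proof -
    define v :: "real ^ 'd" where "v = (\<chi> i. of_int (h i))"
    have "v \<noteq> 0" using that by (auto simp: v_def vec_eq_iff)
    define t where "t n = v v* A n" for n
    have char_eq: "character h (A n *v x) = cis (2 * pi * (t n \<bullet> x))" for n x
      unfolding t_def dot_lmul_matrix by (simp add: character_def v_def inner_vec_def)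
    obtain c where "c > 0" and c: "\<And>m n. 1 \<le> m \<Longrightarrow> m < n \<Longrightarrow> c * K ^ n \<le> norm (t n - t m)"
      using frequency_gap[of A K v] assms(4-6) \<open>v \<noteq> 0\<close> expanding_integral_matrix_invertible
      unfolding t_def by metis
    obtain C \<alpha> where "C \<ge> 0" "\<alpha> > 0" and
      C: "\<And>m n. 1 \<le> m \<Longrightarrow> m < n \<Longrightarrow> norm (fourier_transform \<mu> (t m - t n)) \<le> C * real n powr (- \<alpha>)"
      using polylog_fourier_decay_along_gaps[OF assms(1,3) \<open>c > 0\<close> assms(5) c] by auto
    show ?thesis
    proof (rule AE_averages_tendsto_0)
      show "(\<lambda>x. character h (A n *v x)) \<in> borel_measurable \<mu>" for n
        unfolding char_eq measurable_cong_sets[OF assms(2) refl]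
        by (intro borel_measurable_continuous_onI continuous_intros)
      show "norm (character h (A n *v x)) \<le> 1" for n x by simp
      fix m n :: nat assume mn: "1 \<le> m" "m < n"
      have "character h (A n *v x) * cnj (character h (A m *v x))
          = exp (- (2 * complex_of_real pi * \<i> * complex_of_real ((t m - t n) \<bullet> x)))" for x
      proof -
        have "character h (A n *v x) * cnj (character h (A m *v x)) = cis (- (2 * pi * ((t m - t n) \<bullet> x)))"
          unfolding char_eq cis_cnj cis_mult by (simp add: inner_diff_left algebra_simps)
        then show ?thesis by (simp add: cis_conv_exp mult_ac)
      qed
      then have "expectation (\<lambda>x. character h (A n *v x) * cnj (character h (A m *v x)))
          = fourier_transform \<mu> (t m - t n)"
        by (simp add: fourier_transform_def)
      then show "norm (expectation (\<lambda>x. character h (A n *v x) * cnj (character h (A m *v x))))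
          \<le> C * real n powr (- \<alpha>)"
        using C[OF mn] by simp
    qed fact+
  qed
  then have "AE x in \<mu>. \<forall>h. h \<noteq> (\<lambda>_. 0) \<longrightarrow>
      (\<lambda>N. (\<Sum>n\<in>{1..N}. character h (A n *v x)) / of_nat N) \<longlonglongrightarrow> 0"
    unfolding AE_all_countable by simp
  then show ?thesis
    by eventually_elim (rule weyl_criterion, blast)
qed

end
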